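(* Let $H$ be an $\mathbb O$-Hilbert space and let $f:H\to\mathbb O$ be a continuous $\mathbb O$-para-linear function. For any nonzero $p\in\mathbb O$ and any $x\in H$, $$(f\odot p)(x)=p\,f(p^{-1}x)\,p,$$ where $(f\odot p)(x):=f(x)p-[p,x,f]$.
   Context: $\mathbb O$ denotes the octonions, with conjugation $\overline{\,\cdot\,}$ and real part $\mathrm{Re}$. The product $pap$ is unambiguous for $p,a\in\mathbb O$ since $(pa)p=p(ap)$. A left $\mathbb O$-module is a real vector space $M$ with an $\mathbb R$-bilinear scalar multiplication $\mathbb O\times M\to M$, $1m=m$, such that $r(rm)=r^2m$ for all $r\in\mathbb O$, $m\in M$ (equivalently, $[p,q,m]:=(pq)m-p(qm)$ satisfies $[p,q,m]=-[q,p,m]$). For a real linear $f:M\to\mathbb O$ put $[p,x,f]:=f(px)-pf(x)$ ($p\in\mathbb O$, $x\in M$). The map $f$ is $\mathbb O$-para-linear if $\mathrm{Re}\,[p,x,f]=0$ for all $p,x$. A pre-Hilbert left $\mathbb O$-module is a left $\mathbb O$-module $H$ with an $\mathbb R$-bilinear map $\langle\cdot,\cdot\rangle:H\times H\to\mathbb O$ such that: (1) $\langle\cdot,u\rangle$ is $\mathbb O$-para-linear for all $u\in H$; (2) $\langle u,v\rangle=\overline{\langle v,u\rangle}$; (3) $\langle u,u\rangle$ is a nonnegative real number, equal to $0$ iff $u=0$. An $\mathbb O$-Hilbert space is a pre-Hilbert left $\mathbb O$-module complete with respect to $\|u\|=\sqrt{\langle u,u\rangle}$. *)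

theory Defs
  imports "HOL-Analysis.Analysis"
begin

section \<open>Octonions\<close>

text \<open>Octonions are given by their coordinates with respect to the basis
  $1, e_1, \ldots, e_7$.\<close>

datatype octo = Octo
  (oRe: real) (oIm1: real) (oIm2: real) (oIm3: real)
  (oIm4: real) (oIm5: real) (oIm6: real) (oIm7: real)

lemma octo_eq_iff:
  "a = b \<longleftrightarrow> oRe a = oRe b \<and> oIm1 a = oIm1 b \<and> oIm2 a = oIm2 b \<and> oIm3 a = oIm3 b \<and>
    oIm4 a = oIm4 b \<and> oIm5 a = oIm5 b \<and> oIm6 a = oIm6 b \<and> oIm7 a = oIm7 b"
  by (cases a; cases b) auto

instantiation octo :: ab_group_add
begin
definition "0 = Octo 0 0 0 0 0 0 0 0"
definition "a + b = Octo
  (oRe a + oRe b) (oIm1 a + oIm1 b) (oIm2 a + oIm2 b) (oIm3 a + oIm3 b)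
  (oIm4 a + oIm4 b) (oIm5 a + oIm5 b) (oIm6 a + oIm6 b) (oIm7 a + oIm7 b)"
definition "a - b = Octo
  (oRe a - oRe b) (oIm1 a - oIm1 b) (oIm2 a - oIm2 b) (oIm3 a - oIm3 b)
  (oIm4 a - oIm4 b) (oIm5 a - oIm5 b) (oIm6 a - oIm6 b) (oIm7 a - oIm7 b)"
definition "- a = Octo
  (- oRe a) (- oIm1 a) (- oIm2 a) (- oIm3 a)
  (- oIm4 a) (- oIm5 a) (- oIm6 a) (- oIm7 a)"
instance
  by standard
    (auto simp: octo_eq_iff zero_octo_def plus_octo_def minus_octo_def uminus_octo_def)
end

text \<open>The multiplication is determined by $e_i^2 = -1$, $e_i e_j = -e_j e_i$ for
  $i \neq j$ and $e_i e_j = e_k$ for $(i,j,k)$ one of $(1,2,3)$, $(1,4,5)$, $(1,7,6)$,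
  $(2,4,6)$, $(2,5,7)$, $(3,4,7)$, $(3,6,5)$ or a cyclic permutation of one of them.\<close>

instantiation octo :: "{one, times}"
begin
definition "1 = Octo 1 0 0 0 0 0 0 0"
definition "a * b = Octo
  (oRe a * oRe b
    - oIm1 a * oIm1 b - oIm2 a * oIm2 b - oIm3 a * oIm3 b - oIm4 a * oIm4 b
    - oIm5 a * oIm5 b - oIm6 a * oIm6 b - oIm7 a * oIm7 b)
  (oRe a * oIm1 b + oIm1 a * oRe b
    + oIm2 a * oIm3 b - oIm3 a * oIm2 b
    + oIm4 a * oIm5 b - oIm5 a * oIm4 b
    + oIm7 a * oIm6 b - oIm6 a * oIm7 b)
  (oRe a * oIm2 b + oIm2 a * oRe b
    + oIm3 a * oIm1 b - oIm1 a * oIm3 b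
    + oIm4 a * oIm6 b - oIm6 a * oIm4 b
    + oIm5 a * oIm7 b - oIm7 a * oIm5 b)
  (oRe a * oIm3 b + oIm3 a * oRe b
    + oIm1 a * oIm2 b - oIm2 a * oIm1 b
    + oIm4 a * oIm7 b - oIm7 a * oIm4 b
    + oIm6 a * oIm5 b - oIm5 a * oIm6 b)
  (oRe a * oIm4 b + oIm4 a * oRe b
    + oIm5 a * oIm1 b - oIm1 a * oIm5 b
    + oIm6 a * oIm2 b - oIm2 a * oIm6 b
    + oIm7 a * oIm3 b - oIm3 a * oIm7 b)
  (oRe a * oIm5 b + oIm5 a * oRe b
    + oIm1 a * oIm4 b - oIm4 a * oIm1 b
    + oIm7 a * oIm2 b - oIm2 a * oIm7 b
    + oIm3 a * oIm6 b - oIm6 a * oIm3 b)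
  (oRe a * oIm6 b + oIm6 a * oRe b
    + oIm1 a * oIm7 b - oIm7 a * oIm1 b
    + oIm2 a * oIm4 b - oIm4 a * oIm2 b
    + oIm5 a * oIm3 b - oIm3 a * oIm5 b)
  (oRe a * oIm7 b + oIm7 a * oRe b
    + oIm6 a * oIm1 b - oIm1 a * oIm6 b
    + oIm2 a * oIm5 b - oIm5 a * oIm2 b
    + oIm3 a * oIm4 b - oIm4 a * oIm3 b)"
instance ..
end

instantiation octo :: real_inner
begin
definition "r *\<^sub>R a = Octo
  (r * oRe a) (r * oIm1 a) (r * oIm2 a) (r * oIm3 a)
  (r * oIm4 a) (r * oIm5 a) (r * oIm6 a) (r * oIm7 a)"
definition "inner a b =
  oRe a * oRe b + oIm1 a * oIm1 b + oIm2 a * oIm2 b + oIm3 a * oIm3 b +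
  oIm4 a * oIm4 b + oIm5 a * oIm5 b + oIm6 a * oIm6 b + oIm7 a * oIm7 b"
definition "norm (a::octo) = sqrt (inner a a)"
definition "sgn (a::octo) = inverse (norm a) *\<^sub>R a"
definition "dist (a::octo) b = norm (a - b)"
definition "(uniformity :: (octo \<times> octo) filter) =
  (INF e\<in>{0<..}. principal {(x, y). dist x y < e})"
definition "open (U :: octo set) \<longleftrightarrow>
  (\<forall>x\<in>U. eventually (\<lambda>(x', y). x' = x \<longrightarrow> y \<in> U) uniformity)"
instance
proof
  fix a b c :: octo and r s :: real and U :: "octo set"
  show "r *\<^sub>R (a + b) = r *\<^sub>R a + r *\<^sub>R b" "(r + s) *\<^sub>R a = r *\<^sub>R a + s *\<^sub>R a"
    "r *\<^sub>R s *\<^sub>R a = (r * s) *\<^sub>R a" "1 *\<^sub>R a = a"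
    by (simp_all add: octo_eq_iff scaleR_octo_def plus_octo_def algebra_simps)
  show "sgn a = inverse (norm a) *\<^sub>R a" "dist a b = norm (a - b)" "norm a = sqrt (inner a a)"
    by (rule sgn_octo_def dist_octo_def norm_octo_def)+
  show "uniformity = (INF e\<in>{0<..}. principal {(x :: octo, y). dist x y < e})"
    "open U \<longleftrightarrow> (\<forall>x\<in>U. eventually (\<lambda>(x', y). x' = x \<longrightarrow> y \<in> U) uniformity)"
    by (rule uniformity_octo_def open_octo_def)+
  show "inner a b = inner b a"
    by (simp add: inner_octo_def mult.commute)
  show "inner (a + b) c = inner a c + inner b c"
    by (simp add: inner_octo_def plus_octo_def algebra_simps)
  show "inner (r *\<^sub>R a) b = r * inner a b"
    by (simp add: inner_octo_def scaleR_octo_def algebra_simps)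
  show "0 \<le> inner a a"
    by (simp add: inner_octo_def)
  show "inner a a = 0 \<longleftrightarrow> a = 0"
    by (simp add: inner_octo_def zero_octo_def octo_eq_iff add_nonneg_eq_0_iff)
qed
end

definition octo_cnj :: "octo \<Rightarrow> octo" where
  "octo_cnj a = Octo (oRe a) (- oIm1 a) (- oIm2 a) (- oIm3 a) (- oIm4 a) (- oIm5 a) (- oIm6 a) (- oIm7 a)"

instantiation octo :: inverse
begin
definition "inverse a = (1 / (norm a)\<^sup>2) *\<^sub>R octo_cnj a"
definition "a div b = a * inverse (b::octo)"
instance ..
end

lemmas octo_coord_defs = octo_eq_iff zero_octo_def plus_octo_def minus_octo_def uminus_octo_def
  one_octo_def times_octo_def scaleR_octo_def octo_cnj_def

lemma octo_mult_cnj: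
  "a * octo_cnj a = (norm a)\<^sup>2 *\<^sub>R 1" "octo_cnj a * a = (norm a)\<^sup>2 *\<^sub>R 1"
proof -
  have "(norm a)\<^sup>2 = inner a a" for a :: octo
    by (simp add: power2_norm_eq_inner)
  then show "a * octo_cnj a = (norm a)\<^sup>2 *\<^sub>R 1" "octo_cnj a * a = (norm a)\<^sup>2 *\<^sub>R 1"
    by (simp_all add: octo_coord_defs inner_octo_def algebra_simps)
qed

lemma octo_mult_scaleR: "a * (r *\<^sub>R b) = r *\<^sub>R (a * b)" "(r *\<^sub>R a) * b = r *\<^sub>R (a * b)"
  for a b :: octo
  by (simp_all add: octo_coord_defs algebra_simps)

lemma octo_inverse:
  fixes p :: octo
  assumes "p \<noteq> 0"
  shows "p * inverse p = 1" "inverse p * p = 1"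
  using assms by (simp_all add: inverse_octo_def octo_mult_scaleR octo_mult_cnj)

text \<open>The product $pap$ does not depend on the bracketing.\<close>

lemma octo_alternative:
  fixes p a :: octo
  shows "p * (p * a) = (p * p) * a" "(a * p) * p = a * (p * p)" "(p * a) * p = p * (a * p)"
  unfolding times_octo_def octo.sel octo.inject
  by (intro conjI; algebra)+

section \<open>Octonionic modules and Hilbert spaces\<close>

text \<open>The underlying real vector space is the type \<open>'m\<close>; \<open>smul\<close> is the scalar multiplication.\<close>

locale octo_left_module =
  fixes smul :: "octo \<Rightarrow> 'm::real_vector \<Rightarrow> 'm"
  assumes bilinear_smul: "bilinear smul"
    and smul_one: "smul 1 m = m"
    and smul_smul_same: "smul r (smul r m) = smul (r * r) m"

definition assoc_fun :: "(octo \<Rightarrow> 'm \<Rightarrow> 'm) \<Rightarrow> octo \<Rightarrow> 'm \<Rightarrow> ('m::real_vector \<Rightarrow> octo) \<Rightarrow> octo" where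
  "assoc_fun smul p x f = f (smul p x) - p * f x"

definition para_linear :: "(octo \<Rightarrow> 'm \<Rightarrow> 'm) \<Rightarrow> ('m::real_vector \<Rightarrow> octo) \<Rightarrow> bool" where
  "para_linear smul f \<longleftrightarrow> linear f \<and> (\<forall>p x. oRe (assoc_fun smul p x f) = 0)"

definition odot :: "(octo \<Rightarrow> 'm \<Rightarrow> 'm) \<Rightarrow> ('m::real_vector \<Rightarrow> octo) \<Rightarrow> octo \<Rightarrow> 'm \<Rightarrow> octo" where
  "odot smul f p x = f x * p - assoc_fun smul p x f"

locale octo_pre_hilbert = octo_left_module smul
  for smul :: "octo \<Rightarrow> 'h::real_vector \<Rightarrow> 'h" +
  fixes ip :: "'h \<Rightarrow> 'h \<Rightarrow> octo"
  assumes bilinear_ip: "bilinear ip"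
    and para_linear_ip: "para_linear smul (\<lambda>v. ip v u)"
    and ip_cnj: "ip u v = octo_cnj (ip v u)"
    and ip_nonneg: "\<exists>r\<ge>0. ip u u = r *\<^sub>R 1"
    and ip_eq_0_iff: "ip u u = 0 \<longleftrightarrow> u = 0"

definition ip_norm :: "('h \<Rightarrow> 'h \<Rightarrow> octo) \<Rightarrow> 'h \<Rightarrow> real" where
  "ip_norm ip u = sqrt (oRe (ip u u))"

definition ip_dist :: "('h \<Rightarrow> 'h \<Rightarrow> octo) \<Rightarrow> 'h::real_vector \<Rightarrow> 'h \<Rightarrow> real" where
  "ip_dist ip u v = ip_norm ip (u - v)"

lemma (in octo_pre_hilbert) Metric_space_ip_dist: "Metric_space UNIV (ip_dist ip)"
proof -
  define B where "B u v = oRe (ip u v)" for u v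
  have lin1: "linear (\<lambda>u. ip u v)" and lin2: "linear (\<lambda>v. ip u v)" for u v
    using bilinear_ip by (auto simp: bilinear_def)
  have B_add: "B (u + v) w = B u w + B v w" "B w (u + v) = B w u + B w v" for u v w
    using linear_add[OF lin1] linear_add[OF lin2] by (simp_all add: B_def plus_octo_def)
  have B_diff: "B (u - v) w = B u w - B v w" "B w (u - v) = B w u - B w v" for u v w
    using linear_diff[OF lin1] linear_diff[OF lin2] by (simp_all add: B_def minus_octo_def)
  have B_scale: "B (r *\<^sub>R u) w = r * B u w" "B w (r *\<^sub>R u) = r * B w u" for r u w
    using linear_scale[OF lin1] linear_scale[OF lin2] by (simp_all add: B_def scaleR_octo_def)
  have sym: "B u v = B v u" for u v
    by (simp add: B_def ip_cnj[of u v] octo_cnj_def)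
  have nonneg: "0 \<le> B u u" for u
    using ip_nonneg[of u] by (auto simp: B_def scaleR_octo_def one_octo_def)
  have zero: "B u u = 0 \<longleftrightarrow> u = 0" for u
    using ip_nonneg[of u] ip_eq_0_iff[of u]
    by (auto simp: B_def scaleR_octo_def one_octo_def zero_octo_def)
  have CS: "B u v \<le> sqrt (B u u) * sqrt (B v v)" for u v
  proof -
    define s t where "s = sqrt (B u u)" and "t = sqrt (B v v)"
    have st: "s\<^sup>2 = B u u" "t\<^sup>2 = B v v" "0 \<le> s" "0 \<le> t"
      by (simp_all add: s_def t_def nonneg)
    show ?thesis
    proof (cases "s = 0 \<or> t = 0")
      case True
      then have "u = 0 \<or> v = 0"
        using zero[of u] zero[of v] by (auto simp: s_def t_def)
      then have "B u v = 0"
        using B_scale(1)[of 0 u v] B_scale(2)[of u 0 v] by auto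
      then show ?thesis
        by (simp add: nonneg)
    next
      case False
      have "0 \<le> B (t *\<^sub>R u - s *\<^sub>R v) (t *\<^sub>R u - s *\<^sub>R v)"
        by (rule nonneg)
      also have "\<dots> = t\<^sup>2 * B u u - 2 * (s * t) * B u v + s\<^sup>2 * B v v"
        by (simp add: B_diff B_scale sym[of v u] algebra_simps power2_eq_square)
      also have "\<dots> = 2 * (s * t) * (s * t - B u v)"
        unfolding st(1,2)[symmetric] by (simp add: algebra_simps power2_eq_square)
      finally have "0 \<le> s * t - B u v"
        using False st(3,4) by (auto simp: zero_le_mult_iff mult_le_0_iff)
      then show ?thesis
        by (simp add: s_def t_def)
    qed
  qed
  have tri: "sqrt (B (u + v) (u + v)) \<le> sqrt (B u u) + sqrt (B v v)" for u v
  proof (rule real_le_lsqrt)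
    show "0 \<le> sqrt (B u u) + sqrt (B v v)"
      by (simp add: nonneg)
    show "B (u + v) (u + v) \<le> (sqrt (B u u) + sqrt (B v v))\<^sup>2"
      using CS[of u v] nonneg by (simp add: power2_sum B_add sym[of v u])
  qed
  have dist: "ip_dist ip u v = sqrt (B (u - v) (u - v))" for u v
    by (simp add: ip_dist_def ip_norm_def B_def)
  show ?thesis
  proof
    fix x y z
    show "0 \<le> ip_dist ip x y"
      by (simp add: dist nonneg)
    show "ip_dist ip x y = ip_dist ip y x"
      by (simp add: dist B_diff)
    show "ip_dist ip x y = 0 \<longleftrightarrow> x = y"
      by (simp add: dist zero)
    show "ip_dist ip x z \<le> ip_dist ip x y + ip_dist ip y z"
      using tri[of "x - y" "y - z"] by (simp add: dist)
  qed
qed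

locale octo_hilbert = octo_pre_hilbert smul ip
  for smul :: "octo \<Rightarrow> 'h::real_vector \<Rightarrow> 'h" and ip :: "'h \<Rightarrow> 'h \<Rightarrow> octo" +
  assumes complete: "Metric_space.mcomplete UNIV (ip_dist ip)"

end

theory Submission
  imports Defs
begin

text \<open>Put $y = p^{-1}x$, $A = [p,y,f]$ and $t = 2\,\mathrm{Re}\,p$. From $p^2 = tp - |p|^2$ one
  gets $[p,py,f] = \overline{p}A = tA - pA$, so the claim reads $Ap + pA = tA$. As
  $\mathrm{Re}\,A = 0$, this says that $A$ is orthogonal to the imaginary part of $p$, which is
  para-linearity at $py$: $\mathrm{Re}(\overline{p}A) = 0$.\<close>

lemma octo_distrib:
  fixes a b c :: octo
  shows "a * (b + c) = a * b + a * c" "(a + b) * c = a * c + b * c"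
    "a * (b - c) = a * b - a * c" "(a - b) * c = a * c - b * c"
  by (simp_all add: octo_coord_defs algebra_simps)

lemma octo_one_mult:
  fixes a :: octo
  shows "1 * a = a" "a * 1 = a"
  by (simp_all add: octo_coord_defs)

lemma octo_cnj_eq: "octo_cnj p = (2 * oRe p) *\<^sub>R 1 - p"
  by (simp add: octo_coord_defs)

text \<open>The quadratic equation of \<open>p\<close>: expand \<open>p * octo_cnj p\<close> with
  the conjugate written as 2 Re p - p.\<close>

lemma octo_square: "p * p = (2 * oRe p) *\<^sub>R p - (norm p)\<^sup>2 *\<^sub>R 1"
proof -
  have "(norm p)\<^sup>2 *\<^sub>R 1 = p * octo_cnj p"
    by (simp add: octo_mult_cnj)
  also have "\<dots> = (2 * oRe p) *\<^sub>R p - p * p"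
    by (simp add: octo_cnj_eq octo_distrib octo_mult_scaleR octo_one_mult)
  finally show ?thesis
    by simp
qed

text \<open>The second hypothesis is orthogonality of \<open>a\<close> and \<open>p\<close>.
  Orthogonal imaginary octonions anticommute, so only the real part of \<open>p\<close>
  contributes.\<close>

lemma octo_anticommutator:
  assumes "oRe a = 0" "oRe (octo_cnj p * a) = 0"
  shows "a * p + p * a = (2 * oRe p) *\<^sub>R a"
  using assms by (simp add: octo_coord_defs algebra_simps)

context octo_left_module
begin

lemma linear_smul: "linear (\<lambda>r. smul r m)" "linear (smul r)"
  using bilinear_smul by (auto simp: bilinear_def)

lemma smul_smul:
  "smul p (smul p m) = (2 * oRe p) *\<^sub>R smul p m - (norm p)\<^sup>2 *\<^sub>R m"
  by (simp add: smul_smul_same octo_square linear_diff[OF linear_smul(1)]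
      linear_scale[OF linear_smul(1)] smul_one)

text \<open>The action need not be associative, but \<open>inverse p\<close> lies in the real span
  of 1 and \<open>p\<close>, so \<open>smul_smul\<close> suffices.\<close>

lemma smul_inverse:
  assumes "p \<noteq> 0"
  shows "smul p (smul (inverse p) m) = m"
proof -
  have "smul (octo_cnj p) m = (2 * oRe p) *\<^sub>R m - smul p m"
    by (simp add: octo_cnj_eq linear_diff[OF linear_smul(1)] linear_scale[OF linear_smul(1)]
        smul_one)
  then have "smul p (smul (octo_cnj p) m) = (norm p)\<^sup>2 *\<^sub>R m"
    by (simp add: smul_smul linear_diff[OF linear_smul(2)] linear_scale[OF linear_smul(2)])
  then show ?thesis
    using assms by (simp add: inverse_octo_def linear_scale[OF linear_smul(1)]
        linear_scale[OF linear_smul(2)])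
qed

lemma para_linear_smul_smul:
  assumes "para_linear smul f"
  shows "f (smul p (smul p y)) = (2 * oRe p) *\<^sub>R f (smul p y) - (norm p)\<^sup>2 *\<^sub>R f y"
  using assms by (simp add: para_linear_def smul_smul linear_diff linear_scale)

text \<open>The same quadratic equation reduces p(py) in the module and p(p f(y)) in the octonions;
  the norm terms cancel.\<close>

lemma assoc_fun_smul:
  assumes "para_linear smul f"
  shows "assoc_fun smul p (smul p y) f = octo_cnj p * assoc_fun smul p y f"
  unfolding assoc_fun_def para_linear_smul_smul[OF assms]
  by (simp add: octo_cnj_eq octo_distrib octo_mult_scaleR octo_one_mult octo_alternative(1)
      octo_square scaleR_diff_right)

text \<open>The substitution x = py clears the inverse from the claim.\<close>

lemma odot_smul:
  assumes "para_linear smul f"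
  shows "odot smul f p (smul p y) = p * f y * p"
proof -
  define A where "A = assoc_fun smul p y f"
  \<comment> \<open>Para-linearity at y, then at py.\<close>
  have "oRe A = 0" "oRe (octo_cnj p * A) = 0"
    using assms assoc_fun_smul[OF assms, of p y] unfolding A_def para_linear_def by metis+
  then have *: "A * p + p * A = (2 * oRe p) *\<^sub>R A"
    by (rule octo_anticommutator)
  have f: "f (smul p y) = p * f y + A"
    by (simp add: A_def assoc_fun_def)
  have "odot smul f p (smul p y) = (p * f y + A) * p - octo_cnj p * A"
    by (simp add: odot_def assoc_fun_smul[OF assms] A_def[symmetric] f)
  also have "\<dots> = p * f y * p + (A * p + p * A - (2 * oRe p) *\<^sub>R A)"
    by (simp add: octo_cnj_eq octo_distrib octo_mult_scaleR octo_one_mult algebra_simps)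
  finally show ?thesis
    by (simp add: *)
qed

end

theorem lemma5p1:
  fixes smul :: "octo \<Rightarrow> 'h::real_vector \<Rightarrow> 'h"
    and ip :: "'h \<Rightarrow> 'h \<Rightarrow> octo"
    and f :: "'h \<Rightarrow> octo"
    and p :: octo
    and x :: 'h
  assumes "octo_hilbert smul ip"
    and "continuous_map (Metric_space.mtopology UNIV (ip_dist ip)) euclidean f"
    and "para_linear smul f"
    and "p \<noteq> 0"
  shows "odot smul f p x = p * f (smul (inverse p) x) * p"
proof -
  interpret octo_hilbert smul ip
    by fact
  show ?thesis
    using odot_smul[OF assms(3), of p "smul (inverse p) x"] by (simp add: smul_inverse assms(4))
qed

end
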